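(* Let $K$ be a field, let $R$ be an associative unital $K$-algebra generated by a finite set $X$, and suppose that $R$ is without zero divisors. Let $I$ be a right ideal of $R$. If $\Gamma_{R/I}(n)\prec\Gamma_R(n)$, then $I$ is essential.
   Context: For $n\ge 0$ let $R^{(n)}=\sum_{i=0}^n KX^i$, the $K$-span of all products of at most $n$ elements of $X$ (the empty product being $1$). The growth function of $R$ is $\Gamma_R(n)=\dim_K R^{(n)}$. For a right ideal $I$ of $R$, its growth function is $\Gamma_I(n)=\dim_K(I\cap R^{(n)})$ and its cogrowth function is $\Gamma_{R/I}(n)=\Gamma_R(n)-\Gamma_I(n)$. For functions $\Gamma_1,\Gamma_2$ on the non-negative integers: $\Gamma_1(n)\preceq\Gamma_2(n)$ means that there exists a positive integer $C$ such that $\Gamma_1(n)\le\Gamma_2(Cn)$ for all $n\ge 0$; $\Gamma_1(n)\sim\Gamma_2(n)$ means that there exists a positive integer $C$ such that $\Gamma_1(n)\le\Gamma_2(Cn)$ and $\Gamma_2(n)\le\Gamma_1(Cn)$ for all $n\ge 0$; and $\Gamma_1(n)\prec\Gamma_2(n)$ means that $\Gamma_1(n)\preceq\Gamma_2(n)$ and $\Gamma_1(n)\not\sim\Gamma_2(n)$. A right ideal $I$ of $R$ is essential if it intersects non-trivially every non-zero right ideal of $R$. *)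

theory Defs
  imports Complex_Main
begin

definition growth_le :: "(nat \<Rightarrow> nat) \<Rightarrow> (nat \<Rightarrow> nat) \<Rightarrow> bool" where
  "growth_le f g \<longleftrightarrow> (\<exists>C>0. \<forall>n. f n \<le> g (C * n))"

(* One constant C serves both inequalities. *)
definition growth_equiv :: "(nat \<Rightarrow> nat) \<Rightarrow> (nat \<Rightarrow> nat) \<Rightarrow> bool" where
  "growth_equiv f g \<longleftrightarrow> (\<exists>C>0. \<forall>n. f n \<le> g (C * n) \<and> g n \<le> f (C * n))"

definition growth_less :: "(nat \<Rightarrow> nat) \<Rightarrow> (nat \<Rightarrow> nat) \<Rightarrow> bool" where
  "growth_less f g \<longleftrightarrow> growth_le f g \<and> \<not> growth_equiv f g"

(* The sort {ring, monoid_mult} is that of unital associative rings; unlike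
   ring_1 it does not impose 0 \<noteq> 1. *)

definition right_ideal :: "'a::{ring,monoid_mult} set \<Rightarrow> bool" where
  "right_ideal I \<longleftrightarrow>
     0 \<in> I \<and> (\<forall>x\<in>I. \<forall>y\<in>I. x - y \<in> I) \<and> (\<forall>x\<in>I. \<forall>r. x * r \<in> I)"

definition essential_right_ideal :: "'a::{ring,monoid_mult} set \<Rightarrow> bool" where
  "essential_right_ideal I \<longleftrightarrow>
     right_ideal I \<and> (\<forall>J. right_ideal J \<and> J \<noteq> {0} \<longrightarrow> I \<inter> J \<noteq> {0})"

locale k_algebra = vector_space scale
  for scale :: "'k::field \<Rightarrow> 'a::{ring,monoid_mult} \<Rightarrow> 'a" +
  assumes scale_mult_left: "scale c x * y = scale c (x * y)"
    and scale_mult_right: "x * scale c y = scale c (x * y)"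
begin

definition subalgebra :: "'a set \<Rightarrow> bool" where
  "subalgebra S \<longleftrightarrow> subspace S \<and> 1 \<in> S \<and> (\<forall>x\<in>S. \<forall>y\<in>S. x * y \<in> S)"

definition generated_by :: "'a set \<Rightarrow> bool" where
  "generated_by X \<longleftrightarrow> subalgebra hull X = UNIV"

(* R^(n): the span of all products of at most n elements of X; the empty
   list contributes the empty product 1. *)
definition filtration :: "'a set \<Rightarrow> nat \<Rightarrow> 'a set" where
  "filtration X n = span (prod_list ` {xs. set xs \<subseteq> X \<and> length xs \<le> n})"

definition growth :: "'a set \<Rightarrow> nat \<Rightarrow> nat" where
  "growth X n = dim (filtration X n)"

definition ideal_growth :: "'a set \<Rightarrow> 'a set \<Rightarrow> nat \<Rightarrow> nat" where
  "ideal_growth X I n = dim (I \<inter> filtration X n)"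

(* Subtraction of naturals does not truncate for finite X, see ideal_growth_le. *)
definition cogrowth :: "'a set \<Rightarrow> 'a set \<Rightarrow> nat \<Rightarrow> nat" where
  "cogrowth X I n = growth X n - ideal_growth X I n"

lemma ideal_growth_le:
  assumes "finite X"
  shows "ideal_growth X I n \<le> growth X n"
proof -
  have fin: "finite (prod_list ` {xs. set xs \<subseteq> X \<and> length xs \<le> n})"
    using finite_lists_length_le[OF assms] by simp
  obtain B where B: "B \<subseteq> filtration X n" "independent B"
    "filtration X n \<subseteq> span B" "card B = dim (filtration X n)"
    by (rule basis_exists)
  have "finite B"
    using independent_span_bound[OF fin B(2)] B(1) by (simp add: filtration_def)
  then have "dim (I \<inter> filtration X n) \<le> card B"
    using B(3) by (intro dim_le_card) auto
  with B(4) show ?thesis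
    by (simp add: ideal_growth_def growth_def)
qed

end

end

theory Submission
  imports Defs
begin

text \<open>
  The contrapositive is proved. If \<open>I\<close> is not essential, some non-zero right ideal \<open>J\<close> meets \<open>I\<close>
  only in \<open>0\<close>. Choose \<open>a \<noteq> 0\<close> in \<open>J\<close>, say \<open>a \<in> R\<^bsup>(m)\<^esup>\<close>. Left multiplication by \<open>a\<close> is injective, so
  \<open>aR\<^bsup>(n)\<^esup>\<close> is a copy of \<open>R\<^bsup>(n)\<^esup>\<close> inside \<open>R\<^bsup>(m+n)\<^esup>\<close>; it lies in \<open>J\<close>, hence misses \<open>I\<close>, and so it embeds
  into the quotient of \<open>R\<^bsup>(m+n)\<^esup>\<close> by its intersection with \<open>I\<close>. For \<open>n \<ge> 1\<close> the shift \<open>m + n\<close> is at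
  most \<open>(m + 1)n\<close>, so \<open>\<Gamma>\<^sub>R(n) \<le> \<Gamma>\<^bsub>R/I\<^esub>((m + 1)n)\<close> (\<open>growth_le_cogrowth\<close>);
  for \<open>n = 0\<close> it is enough that \<open>I\<close> contains no non-zero scalar. As always
  \<open>\<Gamma>\<^bsub>R/I\<^esub> \<le> \<Gamma>\<^sub>R\<close>, the two functions are equivalent.

  The dimension count rests on one fact of linear algebra, \<open>dim_add_le\<close>: independent subspaces of
  a finitely spanned space have dimensions adding up to at most that of the space. The
  finite spanning set matters because \<open>dim\<close> is \<open>0\<close> on infinite-dimensional spaces, and \<open>R\<close> itself
  may be one.
\<close>

section \<open>Dimension in finitely spanned subspaces\<close>

context vector_space
begin

text \<open>The vectors of \<open>C\<close> are adjoined to \<open>B\<close> one at a time: a new vector that lies in the span of the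
  old ones differs from an element of the span of \<open>C\<close> by an element of the span of \<open>B\<close>, and that
  element must vanish because it lies in both spans.\<close>

lemma independent_Un:
  assumes "finite C" "independent B" "independent C" "span B \<inter> span C = {0}"
  shows "independent (B \<union> C)"
  using assms
proof (induction C rule: finite_induct)
  case empty
  then show ?case by simp
next
  case (insert c C)
  have c: "c \<notin> span C" and C: "independent C"
    using insert.prems(2) insert.hyps by (auto simp: independent_insert)
  have sub: "span C \<subseteq> span (insert c C)"
    by (rule span_mono) auto
  have "span B \<inter> span C = {0}"
    using insert.prems(3) sub span_zero by blast
  then have ind: "independent (B \<union> C)"
    using insert.IH insert.prems(1) C by blast
  have "c \<notin> span (B \<union> C)"
  proof
    assume "c \<in> span (B \<union> C)"
    then obtain x y where xy: "c = x + y" "x \<in> span B" "y \<in> span C"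
      unfolding span_Un by blast
    have "c - y \<in> span (insert c C)"
      using xy(3) sub by (intro span_diff) (auto simp: span_base)
    then have "x \<in> span B \<inter> span (insert c C)"
      using xy by simp
    then have "x = 0" using insert.prems(3) by blast
    then show False using xy c by simp
  qed
  then show ?case using ind by (simp add: independent_insertI)
qed

lemma dim_mono_finite_span:
  assumes "finite T" "V \<subseteq> span T" "U \<subseteq> V"
  shows "dim U \<le> dim V"
proof -
  obtain B where B: "B \<subseteq> V" "independent B" "V \<subseteq> span B" "card B = dim V"
    by (rule basis_exists)
  have "finite B"
    using independent_span_bound[OF assms(1) B(2)] B(1) assms(2) by blast
  then have "dim U \<le> card B"
    using B(3) assms(3) by (intro dim_le_card) auto
  with B(4) show ?thesis by simp
qed

lemma dim_add_le:
  assumes T: "finite T" "V \<subseteq> span T"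
    and U: "subspace U" "U \<subseteq> V" and W: "subspace W" "W \<subseteq> V" and UW: "U \<inter> W = {0}"
  shows "dim U + dim W \<le> dim V"
proof -
  obtain B where B: "B \<subseteq> U" "independent B" "U \<subseteq> span B" "card B = dim U"
    by (rule basis_exists)
  obtain C where C: "C \<subseteq> W" "independent C" "W \<subseteq> span C" "card C = dim W"
    by (rule basis_exists)
  have fin: "finite B" "finite C"
    using independent_span_bound[OF T(1) B(2)] independent_span_bound[OF T(1) C(2)]
      B(1) C(1) T(2) U(2) W(2) by blast+
  have sp: "span B \<inter> span C = {0}"
    using span_minimal[OF B(1) U(1)] span_minimal[OF C(1) W(1)] UW span_zero by blast
  have "B \<inter> C \<subseteq> {0}"
    using B(1) C(1) UW by blast
  moreover have "0 \<notin> B"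
    using B(2) dependent_zero by blast
  ultimately have "B \<inter> C = {}" by blast
  then have "dim U + dim W = card (B \<union> C)"
    using fin B(4) C(4) by (simp add: card_Un_disjoint)
  also have "\<dots> = dim (B \<union> C)"
    using independent_Un[OF fin(2) B(2) C(2) sp] by (simp add: dim_eq_card_independent)
  also have "\<dots> \<le> dim V"
    using B(1) C(1) U(2) W(2) by (intro dim_mono_finite_span[OF T]) auto
  finally show ?thesis .
qed

lemma dim_image_inj:
  assumes f: "Vector_Spaces.linear scale scale f" and inj: "inj f"
  shows "dim (f ` V) = dim V"
proof -
  interpret f: Vector_Spaces.linear scale scale f by (rule f)
  obtain B where B: "B \<subseteq> V" "independent B" "V \<subseteq> span B" "card B = dim V"
    by (rule basis_exists)
  have "card (f ` B) = dim (f ` V)"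
    using B f.independent_inj_image[OF B(2) inj]
    by (intro basis_card_eq_dim) (auto simp: f.span_image)
  moreover have "card (f ` B) = card B"
    using inj by (intro card_image) (auto intro: inj_on_subset)
  ultimately show ?thesis using B(4) by simp
qed

end

section \<open>The filtration of a finitely generated algebra\<close>

context k_algebra
begin

lemma filtration_finite_span:
  assumes "finite X"
  obtains T where "finite T" "filtration X n = span T"
  using finite_lists_length_le[OF assms] unfolding filtration_def by blast

lemma subspace_filtration: "subspace (filtration X n)"
  by (simp add: filtration_def)

lemma filtration_mono: "m \<le> n \<Longrightarrow> filtration X m \<subseteq> filtration X n"
  unfolding filtration_def by (intro span_mono image_mono) auto

lemma growth_mono:
  assumes "finite X" "m \<le> n"
  shows "growth X m \<le> growth X n"
proof -
  obtain T where "finite T" "filtration X n = span T"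
    using filtration_finite_span[OF assms(1)] .
  then show ?thesis
    unfolding growth_def
    using filtration_mono[OF assms(2)] by (intro dim_mono_finite_span) auto
qed

lemma linear_mult_left: "Vector_Spaces.linear scale scale ((*) a)"
  by unfold_locales (simp_all add: distrib_left scale_mult_right)

lemma linear_mult_right: "Vector_Spaces.linear scale scale (\<lambda>x. x * a)"
  by unfold_locales (simp_all add: distrib_right scale_mult_left)

text \<open>For words this is concatenation; the general case follows by extending linearly in one factor
  and then in the other.\<close>

lemma filtration_mult:
  assumes "x \<in> filtration X m" "y \<in> filtration X n"
  shows "x * y \<in> filtration X (m + n)"
proof -
  let ?P = "\<lambda>n. prod_list ` {xs. set xs \<subseteq> X \<and> length xs \<le> n}"
  have words: "p * q \<in> filtration X (m + n)" if pq: "p \<in> ?P m" "q \<in> ?P n" for p q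
  proof -
    obtain xs ys where "set xs \<subseteq> X" "length xs \<le> m" "p = prod_list xs"
      "set ys \<subseteq> X" "length ys \<le> n" "q = prod_list ys"
      using pq by blast
    then have "p * q = prod_list (xs @ ys)" "set (xs @ ys) \<subseteq> X" "length (xs @ ys) \<le> m + n"
      by auto
    then show ?thesis unfolding filtration_def by (intro span_base) blast
  qed
  have word_left: "p * y \<in> filtration X (m + n)" if p: "p \<in> ?P m" for p
  proof -
    interpret l: Vector_Spaces.linear scale scale "(*) p" by (rule linear_mult_left)
    have "(*) p ` filtration X n = span ((*) p ` ?P n)"
      unfolding filtration_def by (simp only: l.span_image)
    also have "\<dots> \<subseteq> filtration X (m + n)"
      using words[OF p] subspace_filtration by (intro span_minimal) auto
    finally show ?thesis using assms(2) by blast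
  qed
  interpret r: Vector_Spaces.linear scale scale "\<lambda>x. x * y" by (rule linear_mult_right)
  have "(\<lambda>x. x * y) ` filtration X m = span ((\<lambda>x. x * y) ` ?P m)"
    unfolding filtration_def by (simp only: r.span_image)
  also have "\<dots> \<subseteq> filtration X (m + n)"
    using word_left subspace_filtration by (intro span_minimal) auto
  finally show ?thesis using assms(1) by blast
qed

lemma one_in_filtration: "1 \<in> filtration X n"
  unfolding filtration_def by (intro span_base image_eqI[of _ _ "[]"]) auto

text \<open>The pieces of the filtration form an increasing chain closed under products, so their union
  is a subalgebra containing the generators.\<close>

lemma in_some_filtration:
  assumes "generated_by X"
  obtains m where "a \<in> filtration X m"
proof -
  let ?U = "\<Union>m. filtration X m"
  have "X \<subseteq> filtration X 1"
  proof
    fix x assume "x \<in> X"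
    then show "x \<in> filtration X 1"
      unfolding filtration_def by (intro span_base image_eqI[of _ _ "[x]"]) auto
  qed
  then have X: "X \<subseteq> ?U" by blast
  have "x + y \<in> ?U" if xy: "x \<in> ?U" "y \<in> ?U" for x y
  proof -
    obtain m n where "x \<in> filtration X m" "y \<in> filtration X n" using xy by blast
    then have "x \<in> filtration X (max m n)" "y \<in> filtration X (max m n)"
      using filtration_mono[of m "max m n"] filtration_mono[of n "max m n"] by auto
    then show ?thesis using subspace_add[OF subspace_filtration] by blast
  qed
  moreover have "0 \<in> ?U" using subspace_0[OF subspace_filtration] by blast
  moreover have "scale c x \<in> ?U" if "x \<in> ?U" for c x
    using that subspace_scale[OF subspace_filtration] by blast
  ultimately have "subspace ?U" by (intro subspaceI) auto
  moreover have "x * y \<in> ?U" if xy: "x \<in> ?U" "y \<in> ?U" for x y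
  proof -
    obtain m n where "x \<in> filtration X m" "y \<in> filtration X n" using xy by blast
    from filtration_mult[OF this] show ?thesis by blast
  qed
  moreover have "1 \<in> ?U" using one_in_filtration by blast
  ultimately have "subalgebra ?U"
    unfolding subalgebra_def by (intro conjI ballI)
  then have "subalgebra hull X \<subseteq> ?U"
    using X by (intro hull_minimal)
  then show ?thesis
    using assms that unfolding generated_by_def by (auto simp: subset_eq)
qed

section \<open>Growth of right ideals\<close>

text \<open>Right multiplication by the scalar multiple \<open>c\<cdot>1\<close> is scaling by \<open>c\<close>.\<close>

lemma right_ideal_subspace:
  assumes "right_ideal I"
  shows "subspace I"
proof (rule subspaceI)
  show "0 \<in> I" using assms unfolding right_ideal_def by blast
  fix x y c assume x: "x \<in> I"
  have "x * scale c 1 \<in> I" using assms x unfolding right_ideal_def by blast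
  then show "scale c x \<in> I" by (simp add: scale_mult_right)
  assume y: "y \<in> I"
  have "x - (0 - y) \<in> I" using assms x y unfolding right_ideal_def by blast
  then show "x + y \<in> I" by simp
qed

lemma dim_le_cogrowth:
  assumes "finite X" "right_ideal I" "subspace W" "W \<subseteq> filtration X n" "W \<inter> I = {0}"
  shows "dim W \<le> cogrowth X I n"
proof -
  obtain T where "finite T" "filtration X n = span T"
    using filtration_finite_span[OF assms(1)] .
  moreover have "subspace (I \<inter> filtration X n)"
    using right_ideal_subspace[OF assms(2)] subspace_filtration by (rule subspace_inter)
  moreover have "W \<inter> (I \<inter> filtration X n) = {0}"
    using assms(4,5) by blast
  ultimately have "dim W + dim (I \<inter> filtration X n) \<le> dim (filtration X n)"
    using assms(3,4) by (intro dim_add_le[of T]) auto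
  then show ?thesis
    unfolding cogrowth_def growth_def ideal_growth_def by simp
qed

text \<open>The copy of \<open>R\<^bsup>(n)\<^esup>\<close> that misses \<open>I\<close> is \<open>aR\<^bsup>(n)\<^esup>\<close> when \<open>n \<ge> 1\<close>. At \<open>n = 0\<close> the index is not
  allowed to move, and \<open>R\<^bsup>(0)\<^esup>\<close>, the line of scalars, is itself used: a scalar in \<open>I\<close> commutes
  with \<open>a\<close>, which sends it into \<open>I \<inter> J\<close>.\<close>

lemma growth_le_cogrowth:
  assumes X: "finite X" "generated_by X"
    and I: "right_ideal I" and J: "right_ideal J" and IJ: "I \<inter> J = {0}"
    and a: "a \<in> J" "inj ((*) a)"
  shows "growth_le (growth X) (cogrowth X I)"
proof -
  obtain m where m: "a \<in> filtration X m"
    using in_some_filtration[OF X(2)] .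
  have "growth X n \<le> cogrowth X I (Suc m * n)" for n
  proof (cases n)
    case 0
    have "filtration X 0 = span {1}"
      unfolding filtration_def by (rule arg_cong[of _ _ span]) auto
    then have scalars: "\<exists>c. x = scale c 1" if "x \<in> filtration X 0" for x
      using that by (auto simp: span_singleton)
    have "x = 0" if x: "x \<in> filtration X 0" "x \<in> I" for x
    proof -
      obtain c where "x = scale c 1" using scalars x(1) by blast
      then have "a * x = x * a" by (simp add: scale_mult_left scale_mult_right)
      then have "a * x \<in> I \<inter> J" using I J x(2) a(1) unfolding right_ideal_def by (metis IntI)
      then have "a * x = a * 0" using IJ by auto
      then show ?thesis using injD[OF a(2)] by blast
    qed
    then have "filtration X 0 \<inter> I = {0}"
      using I subspace_0[OF subspace_filtration] unfolding right_ideal_def by blast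
    then have "dim (filtration X 0) \<le> cogrowth X I 0"
      using X(1) I subspace_filtration by (intro dim_le_cogrowth) auto
    with 0 show ?thesis by (simp add: growth_def)
  next
    case (Suc k)
    interpret l: Vector_Spaces.linear scale scale "(*) a" by (rule linear_mult_left)
    let ?W = "(*) a ` filtration X n"
    have "m + n \<le> Suc m * n" using Suc by simp
    then have "?W \<subseteq> filtration X (Suc m * n)"
      using filtration_mult[OF m] filtration_mono by blast
    moreover have "subspace ?W"
      by (rule l.subspace_image[OF subspace_filtration])
    moreover have "?W \<inter> I = {0}"
    proof -
      have "?W \<subseteq> J" using J a(1) unfolding right_ideal_def by blast
      then show ?thesis
        using IJ subspace_0[OF \<open>subspace ?W\<close>] by blast
    qed
    ultimately have "dim ?W \<le> cogrowth X I (Suc m * n)"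
      using X(1) I by (intro dim_le_cogrowth) auto
    then show ?thesis
      by (simp add: growth_def dim_image_inj[OF linear_mult_left a(2)])
  qed
  then show ?thesis unfolding growth_le_def by blast
qed

lemma growth_equiv_cogrowth:
  assumes "finite X" "growth_le (growth X) (cogrowth X I)"
  shows "growth_equiv (cogrowth X I) (growth X)"
proof -
  obtain C where C: "C > 0" "\<And>n. growth X n \<le> cogrowth X I (C * n)"
    using assms(2) unfolding growth_le_def by blast
  have "cogrowth X I n \<le> growth X (C * n)" for n
  proof -
    have "cogrowth X I n \<le> growth X n" by (simp add: cogrowth_def)
    also have "\<dots> \<le> growth X (C * n)" using C(1) by (intro growth_mono assms(1)) simp
    finally show ?thesis .
  qed
  with C show ?thesis unfolding growth_equiv_def by blast
qed

end

theorem corollary2p2: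
  fixes scale :: "'k::field \<Rightarrow> 'a::{ring_no_zero_divisors,monoid_mult} \<Rightarrow> 'a"
    and X I :: "'a set"
  assumes "k_algebra scale"
    and "finite X"
    and "k_algebra.generated_by scale X"
    and "right_ideal I"
    and "growth_less (k_algebra.cogrowth scale X I) (k_algebra.growth scale X)"
  shows "essential_right_ideal I"
proof (rule ccontr)
  interpret k_algebra scale by (rule assms(1))
  assume "\<not> essential_right_ideal I"
  then obtain J where J: "right_ideal J" "J \<noteq> {0}" "I \<inter> J = {0}"
    using assms(4) unfolding essential_right_ideal_def by blast
  then obtain a where a: "a \<in> J" "a \<noteq> 0"
    unfolding right_ideal_def by blast
  have "inj ((*) a)"
    using a(2) by (intro injI) simp
  then have "growth_le (growth X) (cogrowth X I)"
    using growth_le_cogrowth[OF assms(2,3,4) J(1,3) a(1)] by blast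
  then have "growth_equiv (cogrowth X I) (growth X)"
    by (rule growth_equiv_cogrowth[OF assms(2)])
  then show False
    using assms(5) unfolding growth_less_def by blast
qed

end
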